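(* Let $n,m$ be even positive integers and let $\mathbf{L}$ be the $nm\times nm$ Laplacian matrix $$\mathbf{L}=\mathbf{I}_n\otimes\big(\mathbf{D}^{(2)}_m+\mathbf{T}_{\sin^2}^{-1}\mathbf{T}_{\cos\sin}\mathbf{D}_m\big)+\mathbf{D}^{(2)}_n\otimes \mathbf{T}_{\sin^2}^{-1}$$ defined in the context. Then all eigenvalues of $\mathbf{L}$ are real and nonpositive.
   Context: Here $\otimes$ is the Kronecker product and $\mathbf{I}_n$ is the $n\times n$ identity. For an even integer $m$: - $\mathbf{D}_m=\mathrm{diag}\big(i\cdot(0,-m/2+1,-m/2+2,\ldots,m/2-1)\big)$ ($m\times m$, $i=\sqrt{-1}$). - $\mathbf{D}^{(2)}_m=\mathrm{diag}\big(-(m/2)^2,-(m/2-1)^2,\ldots,-1,0,-1,\ldots,-(m/2-1)^2\big)$, i.e. diagonal entries $-j^2$ for $j=-m/2,\ldots,m/2-1$; $\mathbf{D}^{(2)}_n$ is defined in the same way with $n$ in place of $m$. - $\mathbf{P}$ is the $(m+1)\times m$ matrix with $\mathbf{P}_{1,1}=\mathbf{P}_{m+1,1}=1/2$, $\mathbf{P}_{j,j}=1$ for $2\le j\le m$, and all other entries zero. - $\mathbf{Q}$ is the $m\times(m+5)$ matrix with $\mathbf{Q}_{j,j+2}=1$ for $1\le j\le m$, $\mathbf{Q}_{1,m+3}=1$, and all other entries zero. - $\mathbf{M}_{\sin^2}$ is the $(m+5)\times(m+5)$ symmetric Toeplitz matrix with $1/2$ on the main diagonal, $-1/4$ on the second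 superdiagonal and second subdiagonal (entries $(r,r\pm2)$), and zeros elsewhere. - $\mathbf{M}_{\cos\sin}$ is the $(m+5)\times(m+5)$ Toeplitz matrix with entries $(r,r+2)$ equal to $i/4$, entries $(r+2,r)$ equal to $-i/4$, and zeros elsewhere. - For a matrix $\mathbf{M}$, $\mathbf{M}(:,3{:}m{+}3)$ denotes the submatrix formed by columns $3$ through $m+3$. - $\mathbf{T}_{\sin^2}=\mathbf{Q}\,\mathbf{M}_{\sin^2}(:,3{:}m{+}3)\,\mathbf{P}$ and $\mathbf{T}_{\cos\sin}=\mathbf{Q}\,\mathbf{M}_{\cos\sin}(:,3{:}m{+}3)\,\mathbf{P}$ (both $m\times m$). These are the matrices of multiplication by $\sin^2\theta$ and $\cos\theta\sin\theta$ acting on vectors of $m$ Fourier coefficients. The matrix $\mathbf{T}_{\sin^2}$ is invertible, so $\mathbf{L}$ is well defined. *)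

theory Defs
  imports Complex_Main "Jordan_Normal_Form.Matrix" "Jordan_Normal_Form.Char_Poly"
begin

text \<open>All matrices are 0-indexed here; the paper's 1-based index j corresponds to j-1.\<close>

definition kron :: "'a::times mat \<Rightarrow> 'a mat \<Rightarrow> 'a mat" where
  "kron A B = mat (dim_row A * dim_row B) (dim_col A * dim_col B)
     (\<lambda>(i,j). A $$ (i div dim_row B, j div dim_col B) * B $$ (i mod dim_row B, j mod dim_col B))"

definition inv_mat :: "'a::semiring_1 mat \<Rightarrow> 'a mat" where
  "inv_mat A = (SOME B. B \<in> carrier_mat (dim_row A) (dim_row A) \<and>
      A * B = 1\<^sub>m (dim_row A) \<and> B * A = 1\<^sub>m (dim_row A))"

definition Dm :: "nat \<Rightarrow> complex mat" where
  "Dm m = mat m m (\<lambda>(r,c). if r = c then (if r = 0 then 0 else \<i> * of_int (int r - int m div 2)) else 0)"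

definition D2 :: "nat \<Rightarrow> complex mat" where
  "D2 m = mat m m (\<lambda>(r,c). if r = c then - (of_int ((int r - int m div 2)^2)) else 0)"

definition Pmat :: "nat \<Rightarrow> complex mat" where
  "Pmat m = mat (m+1) m (\<lambda>(r,c). if c = 0 \<and> (r = 0 \<or> r = m) then 1/2
                            else if r = c \<and> 1 \<le> r \<and> r \<le> m - 1 then 1 else 0)"

definition Qmat :: "nat \<Rightarrow> complex mat" where
  "Qmat m = mat m (m+5) (\<lambda>(r,c). if (c = r + 2) \<or> (r = 0 \<and> c = m + 2) then 1 else 0)"

definition Msin2 :: "nat \<Rightarrow> complex mat" where
  "Msin2 m = mat (m+5) (m+5) (\<lambda>(r,c). if r = c then 1/2
                  else if c = r + 2 \<or> r = c + 2 then -1/4 else 0)"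

definition Mcossin :: "nat \<Rightarrow> complex mat" where
  "Mcossin m = mat (m+5) (m+5) (\<lambda>(r,c). if c = r + 2 then \<i>/4
                  else if r = c + 2 then -\<i>/4 else 0)"

text \<open>M(:,3:m+3): columns 3..m+3 (1-based), i.e. 2..m+2 (0-based)\<close>
definition cols_3_to_m3 :: "nat \<Rightarrow> complex mat \<Rightarrow> complex mat" where
  "cols_3_to_m3 m M = mat (dim_row M) (m+1) (\<lambda>(r,c). M $$ (r, c + 2))"

definition Tsin2 :: "nat \<Rightarrow> complex mat" where
  "Tsin2 m = Qmat m * cols_3_to_m3 m (Msin2 m) * Pmat m"

definition Tcossin :: "nat \<Rightarrow> complex mat" where
  "Tcossin m = Qmat m * cols_3_to_m3 m (Mcossin m) * Pmat m"

definition Lap :: "nat \<Rightarrow> nat \<Rightarrow> complex mat" where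
  "Lap n m = kron (1\<^sub>m n) (D2 m + inv_mat (Tsin2 m) * Tcossin m * Dm m)
             + kron (D2 n) (inv_mat (Tsin2 m))"

end

theory Submission
  imports Defs "Jordan_Normal_Form.Determinant"
begin

text \<open>
  As \<open>D2 n\<close> is diagonal, an eigenvector of \<open>Lap n m\<close> has a nonzero block \<open>v\<close> with
  \<open>T D2 v + S D v = \<kappa> v - \<mu> T v\<close>, where \<open>T\<close> and \<open>S\<close> multiply by \<open>sin\<^sup>2\<close> and \<open>cos sin\<close>,
  \<open>\<kappa> \<ge> 0\<close> is a square and \<open>\<mu>\<close> is minus the eigenvalue. With \<open>a(j) = j (j + 1)\<close> and the flux
  \<open>z(j + 1) = (a(j + 1) - \<mu>) v(j + 2) - (a(j) - \<mu>) v(j)\<close> the interior rows read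
  \<open>z(j + 1) - z(j - 1) = 4 \<kappa> v(j)\<close>. Split \<open>v\<close> into its even and odd part under \<open>j \<mapsto> - j\<close> and
  descend from the top frequency. If \<open>\<mu>\<close> is not real, the ratio \<open>t = z(j + 1) / v(j)\<close> satisfies
  throughout that \<open>Im \<mu> * Im t > 0\<close> and that \<open>Im \<mu> * Im (t / (\<mu> - a(j))) \<ge> 0\<close>, because the
  \<open>a(j)\<close> increase with \<open>j\<close>; if \<open>\<mu> < 0\<close>, it stays real and negative. Either is incompatible with the
  reflection symmetry at frequency 0, so \<open>\<mu>\<close> is real and nonnegative. The invertibility of \<open>T\<close>
  follows from the same descent with \<open>a = 0\<close>, \<open>\<kappa> = 0\<close>, \<open>\<mu> = - 1\<close>.
\<close>

section \<open>The descent\<close>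

definition off_ray :: "complex \<Rightarrow> bool" where
  "off_ray \<mu> \<longleftrightarrow> Im \<mu> \<noteq> 0 \<or> Re \<mu> < 0"

text \<open>For \<open>Im \<mu> > 0\<close> the first disjunct is the sector of the open upper
  half-plane between the ray through \<open>\<mu> - a\<close> and the negative real axis, mirrored
  for \<open>Im \<mu> < 0\<close>. It shrinks as \<open>a\<close> grows. Multiplying by the
  conjugate compares arguments without dividing.\<close>

definition ratio_cone :: "complex \<Rightarrow> real \<Rightarrow> complex \<Rightarrow> bool" where
  "ratio_cone \<mu> a t \<longleftrightarrow>
     Im \<mu> * Im t > 0 \<and> Im \<mu> * Im (t * cnj (\<mu> - of_real a)) \<ge> 0 \<or>
     Im \<mu> = 0 \<and> Re \<mu> < 0 \<and> Im t = 0 \<and> Re t < 0"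

lemma off_ray_neq: "off_ray \<mu> \<Longrightarrow> a \<ge> 0 \<Longrightarrow> of_real a - \<mu> \<noteq> 0"
  by (auto simp: off_ray_def complex_eq_iff)

lemma ratio_cone_top: "off_ray \<mu> \<Longrightarrow> a \<ge> 0 \<Longrightarrow> ratio_cone \<mu> a (\<mu> - of_real a)"
  by (auto simp: off_ray_def ratio_cone_def complex_eq_iff algebra_simps)

text \<open>The new ratio t' satisfies t' / (\<open>\<mu> - a2\<close>) = 1 / (1 +
  (\<open>\<mu> - a1\<close>) / s). For nonreal \<open>\<mu>\<close>, s stays on the right side of
  the ray through \<open>\<mu> - a1\<close>; taking the reciprocal, adding 1 and inverting again
  preserve this.\<close>

lemma ratio_cone_step:
  fixes \<mu> t :: complex and a a1 a2 \<kappa> :: real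
  assumes t: "ratio_cone \<mu> a t" and ord: "0 \<le> a2" "a2 \<le> a1" "a1 \<le> a" and \<kappa>: "\<kappa> \<ge> 0"
  defines "s \<equiv> t - of_real (4 * \<kappa>)"
  shows "s + \<mu> - of_real a1 \<noteq> 0"
    and "ratio_cone \<mu> a2 (s * (\<mu> - of_real a2) / (s + \<mu> - of_real a1))"
proof -
  define q where "q = s + \<mu> - of_real a1"
  have ImRe: "Im s = Im t" "Re s = Re t - 4 * \<kappa>"
    by (simp_all add: s_def)
  show "s + \<mu> - of_real a1 \<noteq> 0"
  proof (cases "Im \<mu> = 0")
    case True
    then have "Re q < 0"
      using t ord \<kappa> by (auto simp: ratio_cone_def q_def ImRe)
    then have "q \<noteq> 0" by auto
    then show ?thesis by (simp add: q_def)
  next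
    case False
    then have "Im \<mu> * Im q > 0"
      using t by (auto simp: ratio_cone_def q_def ImRe distrib_left add_pos_nonneg)
    then have "q \<noteq> 0" by auto
    then show ?thesis by (simp add: q_def)
  qed
  then have q0: "q \<noteq> 0" by (simp add: q_def)
  then have qq: "cmod q ^ 2 > 0" by simp
  have quot: "x / q = of_real (1 / cmod q ^ 2) * (x * cnj q)" for x
    by (subst complex_div_cnj) simp
  show "ratio_cone \<mu> a2 (s * (\<mu> - of_real a2) / (s + \<mu> - of_real a1))"
  proof (cases "Im \<mu> = 0")
    case True
    then have neg: "Re \<mu> < 0" "Im t = 0" "Re t < 0"
      using t by (auto simp: ratio_cone_def)
    have "s = of_real (Re s)" "\<mu> = of_real (Re \<mu>)"
      using True neg by (auto simp: complex_eq_iff ImRe)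
    then have "s * (\<mu> - of_real a2) / (s + \<mu> - of_real a1) =
        of_real (Re s * (Re \<mu> - a2) / (Re s + Re \<mu> - a1))"
      by (metis of_real_add of_real_diff of_real_divide of_real_mult)
    moreover have "Re s * (Re \<mu> - a2) > 0" "Re s + Re \<mu> - a1 < 0"
      using neg ord \<kappa> by (auto simp: ImRe intro!: mult_neg_neg)
    ultimately show ?thesis
      using True neg by (simp add: ratio_cone_def divide_pos_neg)
  next
    case False
    define h where "h = Im \<mu>"
    have t1: "h * Im t > 0" and t2: "h * Im (t * cnj (\<mu> - of_real a)) \<ge> 0"
      using t False by (auto simp: ratio_cone_def h_def)
    \<comment> \<open>Lowering \<open>a\<close> to \<open>a1\<close> and subtracting
      \<open>4 * \<kappa>\<close> both add nonnegative terms.\<close>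
    have "h * Im (s * cnj (\<mu> - of_real a1)) =
        h * Im (t * cnj (\<mu> - of_real a)) + (a - a1) * (h * Im t) + 4 * \<kappa> * (h * h)"
      by (simp add: s_def h_def algebra_simps)
    then have s2: "h * Im (s * cnj (\<mu> - of_real a1)) \<ge> 0"
      using t1 t2 ord \<kappa> by simp
    \<comment> \<open>Clearing the denominator with \<open>cnj q\<close> leaves three nonnegative
      terms, the middle one strictly positive; the last uses \<open>a2 \<le> a1\<close>.\<close>
    have "h * Im (s * (\<mu> - of_real a2) * cnj q) =
        h * h * cmod s ^ 2 + (h * Im t) * cmod (\<mu> - of_real a1) ^ 2 +
        (a1 - a2) * (h * Im (s * cnj (\<mu> - of_real a1)))"
      unfolding cmod_power2 by (simp add: q_def h_def ImRe power2_eq_square algebra_simps)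
    moreover have "\<mu> - of_real a1 \<noteq> 0"
      using False by (auto simp: complex_eq_iff)
    ultimately have pos: "h * Im (s * (\<mu> - of_real a2) * cnj q) > 0"
      using t1 s2 ord by (simp add: add_nonneg_pos add_pos_nonneg)
    \<comment> \<open>The factor \<open>\<mu> - of_real a2\<close> meets its conjugate and the part
      |s|^2 of \<open>s * cnj q\<close> is real, so the second condition reduces to
      \<open>s2\<close>.\<close>
    have prod2: "h * Im (s * (\<mu> - of_real a2) * cnj q * cnj (\<mu> - of_real a2)) =
        cmod (\<mu> - of_real a2) ^ 2 * (h * Im (s * cnj (\<mu> - of_real a1)))"
      unfolding cmod_power2 by (simp add: q_def h_def ImRe power2_eq_square algebra_simps)
    have nonneg: "h * Im (s * (\<mu> - of_real a2) * cnj q * cnj (\<mu> - of_real a2)) \<ge> 0"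
      unfolding prod2 by (rule mult_nonneg_nonneg[OF zero_le_power[OF norm_ge_zero] s2])
    have scale: "h * Im (of_real r * x) = r * (h * Im x)" for r x by simp
    define X where "X = s * (\<mu> - of_real a2) * cnj q"
    have "h * Im (s * (\<mu> - of_real a2) / q) > 0"
      unfolding quot scale X_def[symmetric] using pos qq by (simp add: X_def)
    moreover have "h * Im (s * (\<mu> - of_real a2) / q * cnj (\<mu> - of_real a2)) \<ge> 0"
      unfolding quot mult.assoc[of "of_real _"] scale 
      by (rule mult_nonneg_nonneg[OF _ nonneg]) simp
    ultimately show ?thesis
      unfolding ratio_cone_def q_def h_def by blast
  qed
qed

text \<open>The disjunct with both entries zero keeps the downward recursion going once the top entry
  vanishes.\<close>

definition ratio_ok :: "complex \<Rightarrow> real \<Rightarrow> complex \<Rightarrow> complex \<Rightarrow> bool" where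
  "ratio_ok \<mu> a z y \<longleftrightarrow> y = 0 \<and> z = 0 \<or> y \<noteq> 0 \<and> ratio_cone \<mu> a (z / y)"

lemma ratio_ok_top:
  "off_ray \<mu> \<Longrightarrow> a \<ge> 0 \<Longrightarrow> ratio_ok \<mu> a ((\<mu> - of_real a) * y) y"
  by (auto simp: ratio_ok_def ratio_cone_top)

text \<open>Division by \<open>y\<close> turns one step down into the map of
  \<open>ratio_cone_step\<close>. The nonzero denominator there forces \<open>y' \<noteq> 0\<close>,
  so the next ratio exists.\<close>

lemma ratio_ok_step:
  assumes ok: "ratio_ok \<mu> a z y" and \<mu>: "off_ray \<mu>"
    and ord: "0 \<le> a2" "a2 \<le> a1" "a1 \<le> a" and \<kappa>: "\<kappa> \<ge> 0"
    and z': "z - z' = of_real (4 * \<kappa>) * y"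
    and y': "z' = (of_real a1 - \<mu>) * y - (of_real a2 - \<mu>) * y'"
  shows "ratio_ok \<mu> a2 z' y'"
proof -
  have a2: "of_real a2 - \<mu> \<noteq> 0" using \<mu> ord off_ray_neq by simp
  then have a2': "\<mu> - of_real a2 \<noteq> 0" by simp
  show ?thesis
  proof (cases "y = 0")
    case True
    with ok z' y' a2 show ?thesis by (auto simp: ratio_ok_def)
  next
    case False
    define s where "s = z / y - of_real (4 * \<kappa>)"
    have t: "ratio_cone \<mu> a (z / y)" using ok False by (auto simp: ratio_ok_def)
    note st = ratio_cone_step[OF t ord \<kappa>, folded s_def]
    have zs: "z' = s * y"
      using z' False by (simp add: s_def field_simps)
    have ys: "(\<mu> - of_real a2) * y' = y * (s + \<mu> - of_real a1)"
      using y' zs by (simp add: algebra_simps)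
    then have "y' \<noteq> 0" using False st(1) by auto
    moreover have "y' = y * (s + \<mu> - of_real a1) / (\<mu> - of_real a2)"
      using ys a2' by (metis nonzero_mult_div_cancel_left)
    then have "z' / y' = s * (\<mu> - of_real a2) / (s + \<mu> - of_real a1)"
      using zs False st(1) a2' by simp
    ultimately show ?thesis using st(2) by (simp add: ratio_ok_def)
  qed
qed

text \<open>The values \<open>\<rho> - \<tau> * \<mu>\<close> miss the cone: their imaginary part
  never has the strict sign of \<open>Im \<mu>\<close>, and for negative real \<open>\<mu>\<close>
  they are nonnegative. All reflection conditions at the lowest frequency take this form.\<close>

lemma ratio_ok_bottom:
  assumes "ratio_ok \<mu> a z y" and "y = 0 \<or> z = (of_real \<rho> - of_real \<tau> * \<mu>) * y" "\<rho> \<ge> 0" "\<tau> \<ge> 0"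
  shows "y = 0" "z = 0"
proof -
  have "\<not> ratio_cone \<mu> a (of_real \<rho> - of_real \<tau> * \<mu>)"
  proof -
    have "Im \<mu> * Im (of_real \<rho> - of_real \<tau> * \<mu>) = - \<tau> * (Im \<mu> * Im \<mu>)" by simp
    also have "\<dots> \<le> 0" using assms by simp
    finally show ?thesis
      using assms mult_nonneg_nonpos[of \<tau> "Re \<mu>"] by (auto simp: ratio_cone_def)
  qed
  with assms(1,2) show "y = 0" "z = 0"
    by (auto simp: ratio_ok_def)
qed

text \<open>The cone invariant travels down from \<open>d\<close> to 0, where the bottom condition
  forces a zero pair; the recurrences then carry the zeros back up.\<close>

lemma chain_zero:
  fixes \<alpha> \<beta> :: "nat \<Rightarrow> real" and y z :: "nat \<Rightarrow> complex"
  assumes \<mu>: "off_ray \<mu>" and \<kappa>: "\<kappa> \<ge> 0"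
    and top: "ratio_ok \<mu> (\<alpha> d) (z d) (y d)"
    and row: "\<And>i. i < d \<Longrightarrow> z (Suc i) - z i = of_real (4 * \<kappa>) * y (Suc i)"
    and flux: "\<And>i. i < d \<Longrightarrow> z i = (of_real (\<beta> i) - \<mu>) * y (Suc i) - (of_real (\<alpha> i) - \<mu>) * y i"
    and ord: "\<And>i. i < d \<Longrightarrow> 0 \<le> \<alpha> i \<and> \<alpha> i \<le> \<beta> i \<and> \<beta> i \<le> \<alpha> (Suc i)"
    and bottom: "y 0 = 0 \<or> z 0 = (of_real \<rho> - of_real \<tau> * \<mu>) * y 0" "\<rho> \<ge> 0" "\<tau> \<ge> 0"
    and i: "i \<le> d"
  shows "y i = 0 \<and> z i = 0"
proof -
  have "ratio_ok \<mu> (\<alpha> 0) (z 0) (y 0)"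
  proof (rule inc_induct[of 0 d "\<lambda>j. ratio_ok \<mu> (\<alpha> j) (z j) (y j)"])
    fix j assume j: "j < d" and "ratio_ok \<mu> (\<alpha> (Suc j)) (z (Suc j)) (y (Suc j))"
    then show "ratio_ok \<mu> (\<alpha> j) (z j) (y j)"
      using ratio_ok_step[OF _ \<mu> _ _ _ \<kappa> row[OF j] flux[OF j]] ord[OF j] by blast
  qed (use top in auto)
  note base = ratio_ok_bottom[OF this bottom]
  show ?thesis
    using i
  proof (induction i)
    case (Suc i)
    then have "i < d" and zero: "y i = 0" "z i = 0" by auto
    have "of_real (\<beta> i) - \<mu> \<noteq> 0"
      using off_ray_neq[OF \<mu>] ord[OF \<open>i < d\<close>] by force
    then have "y (Suc i) = 0"
      using flux[OF \<open>i < d\<close>] zero by auto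
    with row[OF \<open>i < d\<close>] zero show ?case by simp
  qed (use base in simp)
qed

section \<open>Two-step recurrences over the frequencies from - N to N\<close>

locale band =
  fixes N :: int and a :: "int \<Rightarrow> real" and b \<kappa> :: real and \<mu> :: complex
  assumes N: "N \<ge> 1" and \<mu>: "off_ray \<mu>" and \<kappa>: "\<kappa> \<ge> 0"
    and a_refl: "\<And>j. a (- 1 - j) = a j" and a0: "a 0 \<ge> 0"
    and a_mono: "\<And>i j. 0 \<le> i \<Longrightarrow> i \<le> j \<Longrightarrow> a i \<le> a j"
    and b: "a (N - 2) \<le> b" "b \<ge> 0"
begin

text \<open>\<open>dn j\<close> is four times the coefficient with which entry \<open>j\<close> enters row \<open>j + 2\<close>; by the reflection
  \<open>j \<mapsto> - j\<close>, \<open>dn (- j)\<close> is the one for row \<open>j - 2\<close>. For the Laplacian, \<open>a j = j * (j + 1)\<close> and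
  \<open>b = N\<^sup>2\<close>; the tips \<open>j = N\<close> and \<open>j = - N\<close> differ because the derivative there is set to zero.
  The matrix \<open>Tsin2\<close> itself is the case \<open>a = 0\<close>, \<open>b = 0\<close>, \<open>\<kappa> = 0\<close>, \<open>\<mu> = - 1\<close>.\<close>

definition dn :: "int \<Rightarrow> complex" where
  "dn j = of_real (if \<bar>j\<bar> = N then b else a j) - \<mu>"

definition row_eq :: "(int \<Rightarrow> complex) \<Rightarrow> int \<Rightarrow> bool" where
  "row_eq y j \<longleftrightarrow> dn (- j - 2) * y (j + 2) + dn (j - 2) * y (j - 2) =
     (dn j + dn (- j) + of_real (4 * \<kappa>)) * y j"

lemma a_nonneg: "a j \<ge> 0"
proof (cases "j \<ge> 0")
  case True
  then show ?thesis using a0 a_mono[of 0 j] by simp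
next
  case False
  then show ?thesis using a0 a_mono[of 0 "- 1 - j"] a_refl[of j] by simp
qed

lemma dn_nz: "dn j \<noteq> 0"
  unfolding dn_def using \<mu> off_ray_neq a_nonneg b(2) by simp

lemma dn_interior: "\<bar>j\<bar> < N \<Longrightarrow> dn j = of_real (a j) - \<mu>" by (simp add: dn_def)

text \<open>The symmetry of \<open>a\<close> about - 1/2 makes the coefficients along one parity
  class interlace as a(j), a(j + 1), a(j + 2), the order that the descent requires for j \<ge>
  0.\<close>

lemma dn_neg: "\<bar>j\<bar> < N \<Longrightarrow> dn (- j) = of_real (a (j - 1)) - \<mu>"
  using a_refl[of "j - 1"] by (simp add: dn_def)

lemma dn_tip: "dn N = of_real b - \<mu>" "dn (- N) = of_real b - \<mu>"
  using N by (simp_all add: dn_def)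

text \<open>Rows couple only frequencies that differ by 2, so each residue \<open>c\<close> modulo 2
  gives its own chain, whose last position below \<open>N\<close> has index
  \<open>d\<close>.\<close>

lemma parity_class_zero:
  fixes y :: "int \<Rightarrow> complex" and \<epsilon> :: complex
  assumes \<epsilon>: "\<epsilon> = 1 \<or> \<epsilon> = - 1" and y_refl: "\<And>j. y (- j) = \<epsilon> * y j"
    and row: "\<And>j. \<bar>j\<bar> < N \<Longrightarrow> row_eq y j" and outside: "\<And>j. \<bar>j\<bar> > N \<Longrightarrow> y j = 0"
    and tip: "y N = 0 \<or> dn (N - 2) * y (N - 2) = (2 * dn N + of_real (4 * \<kappa>)) * y N"
    and c: "c = 0 \<or> c = 1" and cN: "c < N"
    and d: "d = nat ((N - 1 - c) div 2)" and i: "i \<le> d"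
  shows "y (c + 2 * int i) = 0 \<and>
    dn (- c - 2 * int i - 2) * y (c + 2 * int i + 2) - dn (c + 2 * int i) * y (c + 2 * int i) = 0"
proof -
  define z where "z j = dn (- j - 2) * y (j + 2) - dn j * y j" for j
  have zdiff: "z j - z (j - 2) = of_real (4 * \<kappa>) * y j" if "\<bar>j\<bar> < N" for j
    using row[OF that] by (simp add: z_def row_eq_def algebra_simps)
  define Y where "Y i = y (c + 2 * int i)" for i
  define Z where "Z i = z (c + 2 * int i)" for i
  have dN: "c + 2 * int d = N - 1 \<or> c + 2 * int d = N - 2"
    using d cN c by (auto simp: nat_div_distrib)
  have top: "ratio_ok \<mu> (a (c + 2 * int d)) (Z d) (Y d)"
    using dN
  proof
    assume e: "c + 2 * int d = N - 1"
    have "Z d = (\<mu> - of_real (a (N - 1))) * Y d"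
      unfolding Z_def Y_def z_def e using N by (simp add: outside dn_interior algebra_simps)
    then show ?thesis using ratio_ok_top[OF \<mu> a_nonneg] e by simp
  next
    assume e: "c + 2 * int d = N - 2"
    then have N2: "N \<ge> 2" using c cN by linarith
    have Zd: "Z d = dn N * y N - dn (N - 2) * y (N - 2)"
      unfolding Z_def z_def e using dn_tip by simp
    have dnN: "dn (N - 2) = of_real (a (N - 2)) - \<mu>"
      using N2 by (intro dn_interior) simp
    have Yd: "Y d = y (N - 2)" by (simp only: Y_def e)
    show ?thesis
    proof (cases "y N = 0")
      case True
      then have "Z d = (\<mu> - of_real (a (N - 2))) * Y d"
        by (simp add: Zd Yd dnN algebra_simps)
      then show ?thesis using ratio_ok_top[OF \<mu> a_nonneg] e by simp
    next
      case False
      \<comment> \<open>The tip row acts as one more descent step, starting from a fictitious flux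
        \<open>(\<mu> - b) * y N\<close> and landing at \<open>N - 2\<close>; hence the comparison
        of \<open>b\<close> with \<open>a (N - 2)\<close>.\<close>
      have "(\<mu> - of_real b) * y N - Z d = of_real (4 * \<kappa>) * y N"
        using False tip unfolding Zd dn_tip by (simp add: algebra_simps)
      moreover have "Z d = (of_real b - \<mu>) * y N - (of_real (a (N - 2)) - \<mu>) * Y d"
        by (simp add: Zd Yd dnN dn_tip)
      ultimately show ?thesis
        using ratio_ok_step[OF ratio_ok_top[OF \<mu> b(2)] \<mu> a_nonneg b(1) order.refl \<kappa>] e by simp
    qed
  qed
  have inner: "c + 2 * int i + 2 < N" "0 \<le> c" if "i < d" for i
    using dN that c by linarith+
  have R: "Z (Suc i) - Z i = of_real (4 * \<kappa>) * Y (Suc i)" if "i < d" for i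
    using zdiff[of "c + 2 * int (Suc i)"] inner[OF that] by (simp add: Z_def Y_def algebra_simps)
  have F: "Z i = (of_real (a (c + 2 * int i + 1)) - \<mu>) * Y (Suc i) - (of_real (a (c + 2 * int i)) - \<mu>) * Y i"
    if "i < d" for i
  proof -
    define k where "k = c + 2 * int i"
    have "k + 2 < N" "0 \<le> k" using inner[OF that] by (simp_all add: k_def)
    then have "dn k = of_real (a k) - \<mu>" "dn (- k - 2) = of_real (a (k + 1)) - \<mu>"
      using dn_interior[of k] dn_neg[of "k + 2"] by (simp_all add: algebra_simps)
    moreover have "Y (Suc i) = y (k + 2)" by (simp add: Y_def k_def algebra_simps)
    ultimately show ?thesis by (simp add: Z_def Y_def z_def flip: k_def)
  qed
  have O: "0 \<le> a (c + 2 * int i) \<and> a (c + 2 * int i) \<le> a (c + 2 * int i + 1) \<and>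
      a (c + 2 * int i + 1) \<le> a (c + 2 * int (Suc i))" if "i < d" for i
    using inner[OF that] by (auto intro!: a_nonneg a_mono)
  \<comment> \<open>Reflection fixes the flux just below the chain. For \<open>c = 0\<close>, an
    even y has \<open>z (- 2) = - z 0\<close>, which halves \<open>4 * \<kappa>\<close>, and an odd
    y has \<open>y 0 = 0\<close>. For \<open>c = 1\<close>, \<open>z (- 1)\<close> vanishes for even
    y and is twice \<open>dn (- 1) * y 1\<close> for odd y, whence
    \<open>\<tau> = 2\<close>.\<close>
  have "\<exists>\<rho> \<tau>. \<rho> \<ge> 0 \<and> \<tau> \<ge> 0 \<and> (Y 0 = 0 \<or> Z 0 = (of_real \<rho> - of_real \<tau> * \<mu>) * Y 0)"
    using c
  proof
    assume c: "c = 0"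
    show ?thesis using \<epsilon>
    proof
      assume \<epsilon>: "\<epsilon> = 1"
      have "z (- 2) = - z 0"
        using y_refl[of 2] \<epsilon> by (simp add: z_def)
      then have "2 * z 0 = of_real (4 * \<kappa>) * y 0"
        using zdiff[of 0] N by simp
      then have "Z 0 = of_real (2 * \<kappa>) * Y 0" by (simp add: Z_def Y_def c)
      then show ?thesis using \<kappa> by (intro exI[of _ "2 * \<kappa>"] exI[of _ 0]) simp
    next
      assume "\<epsilon> = - 1"
      then have "Y 0 = 0" using y_refl[of 0] by (simp add: Y_def c)
      then show ?thesis by (auto intro!: exI[of _ 0])
    qed
  next
    assume c: "c = 1"
    then have N2: "1 < N" using cN by simp
    have z1: "Z 0 = z (- 1) + of_real (4 * \<kappa>) * Y 0"
      using zdiff[of 1] N2 by (simp add: Z_def Y_def c algebra_simps)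
    have d1: "dn (- 1) = of_real (a 0) - \<mu>"
      using N2 dn_neg[of 1] by simp
    have zm: "z (- 1) = dn (- 1) * (1 - \<epsilon>) * Y 0"
      using y_refl[of 1] by (simp add: z_def Y_def c algebra_simps)
    show ?thesis using \<epsilon>
    proof
      assume "\<epsilon> = 1"
      then show ?thesis using zm z1 \<kappa> by (intro exI[of _ "4 * \<kappa>"] exI[of _ 0]) simp
    next
      assume "\<epsilon> = - 1"
      then show ?thesis using zm z1 \<kappa> a0 d1
        by (intro exI[of _ "4 * \<kappa> + 2 * a 0"] exI[of _ 2]) (simp add: algebra_simps)
    qed
  qed
  then obtain \<rho> \<tau> where "\<rho> \<ge> 0" "\<tau> \<ge> 0" and B: "Y 0 = 0 \<or> Z 0 = (of_real \<rho> - of_real \<tau> * \<mu>) * Y 0"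
    by blast
  then have "Y i = 0 \<and> Z i = 0"
    by (intro chain_zero[of \<mu> \<kappa> "\<lambda>i. a (c + 2 * int i)", OF \<mu> \<kappa> top R F O B _ _ i]) auto
  then show ?thesis by (simp add: Y_def Z_def z_def algebra_simps)
qed

text \<open>The two parity classes exhaust the frequencies below \<open>N\<close>; for
  \<open>N \<ge> 2\<close> the vanishing flux at \<open>N - 2\<close> then kills the tip
  entry.\<close>

lemma reflected_zero:
  fixes y :: "int \<Rightarrow> complex" and \<epsilon> :: complex
  assumes \<epsilon>: "\<epsilon> = 1 \<or> \<epsilon> = - 1" and y_refl: "\<And>j. y (- j) = \<epsilon> * y j"
    and row: "\<And>j. \<bar>j\<bar> < N \<Longrightarrow> row_eq y j" and outside: "\<And>j. \<bar>j\<bar> > N \<Longrightarrow> y j = 0"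
    and tip: "y N = 0 \<or> dn (N - 2) * y (N - 2) = (2 * dn N + of_real (4 * \<kappa>)) * y N"
    and j: "0 \<le> j" "j \<le> N"
  shows "y j = 0"
proof -
  note class_zero = parity_class_zero[OF \<epsilon> y_refl row outside tip _ _ refl]
  have inner: "y j = 0 \<and> dn (- j - 2) * y (j + 2) - dn j * y j = 0" if "0 \<le> j" "j < N" for j
  proof -
    define i where "i = nat (j div 2)"
    have ji: "j = j mod 2 + 2 * int i" using that by (simp add: i_def)
    have "j mod 2 < N" using that ji by linarith
    moreover have "i \<le> nat ((N - 1 - j mod 2) div 2)" using that ji by linarith
    moreover have "j mod 2 = 0 \<or> j mod 2 = 1" by auto
    moreover have "j mod 2 + 2 * int i = j" "- (j mod 2) - 2 * int i - 2 = - j - 2"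
      using ji by linarith+
    ultimately show ?thesis using class_zero[of "j mod 2" i] by metis
  qed
  show ?thesis
  proof (cases "j = N")
    case False
    then show ?thesis using inner j by simp
  next
    case jN: True
    show ?thesis
    proof (cases "N = 1")
      case False
      then have "dn (- N) * y N = 0" using inner[of "N - 2"] N by simp
      then show ?thesis using dn_nz jN by auto
    next
      case True
      \<comment> \<open>Here \<open>N - 2 = - 1\<close> is the opposite tip, so the tip row is a
        scalar equation in \<open>y 1\<close>; its coefficient is nonzero because
        \<open>\<mu>\<close> is off the ray.\<close>
      show ?thesis
      proof (rule ccontr)
        assume ne: "y j \<noteq> 0"
        with tip jN True have e: "dn (- 1) * (\<epsilon> * y 1) = (2 * dn 1 + of_real (4 * \<kappa>)) * y 1"
          using y_refl[of 1] by simp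
        have tips: "dn 1 = of_real b - \<mu>" "dn (- 1) = of_real b - \<mu>"
          unfolding dn_def by (simp_all add: True)
        show False
        proof (cases "\<epsilon> = 1")
          case t: True
          then have "(of_real (b + 4 * \<kappa>) - \<mu>) * y 1 = 0"
            using e[unfolded tips] t by (simp add: algebra_simps)
          then show False using ne jN True off_ray_neq[OF \<mu>, of "b + 4 * \<kappa>"] b(2) \<kappa> by auto
        next
          case False
          then have "(of_real (3 * b + 4 * \<kappa>) - 3 * \<mu>) * y 1 = 0"
            using e[unfolded tips] False \<epsilon> by (simp add: algebra_simps)
          moreover have "of_real (3 * b + 4 * \<kappa>) - 3 * \<mu> = 3 * (of_real (b + 4 / 3 * \<kappa>) - \<mu>)"
            by (simp add: algebra_simps)
          ultimately have "(of_real (b + 4 / 3 * \<kappa>) - \<mu>) * y 1 = 0"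
            by (metis mult_eq_0_iff zero_neq_numeral)
          then show False using ne jN True off_ray_neq[OF \<mu>, of "b + 4 / 3 * \<kappa>"] b(2) \<kappa> by auto
        qed
      qed
    qed
  qed
qed

text \<open>The rows are invariant under reflection, so w plus or minus its reflection solves them
  too. By \<open>glue\<close> the odd part vanishes at \<open>N\<close>, while \<open>tip\<close>
  constrains the even part.\<close>

lemma band_zero:
  fixes w :: "int \<Rightarrow> complex"
  assumes row: "\<And>j. \<bar>j\<bar> < N \<Longrightarrow> row_eq w j" and outside: "\<And>j. \<bar>j\<bar> > N \<Longrightarrow> w j = 0"
    and glue: "w (- N) = w N"
    and tip: "dn (N - 2) * (w (N - 2) + w (2 - N)) = (2 * dn N + of_real (4 * \<kappa>)) * (w N + w (- N))"
  shows "w j = 0"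
proof (cases "\<bar>j\<bar> \<le> N")
  case j: True
  have part: "w \<bar>j\<bar> + \<epsilon> * w (- \<bar>j\<bar>) = 0" if \<epsilon>: "\<epsilon> = 1 \<or> \<epsilon> = - 1" for \<epsilon>
  proof -
    define y where "y j = w j + \<epsilon> * w (- j)" for j
    have sq: "\<epsilon> * \<epsilon> = 1" using \<epsilon> by auto
    show ?thesis
      unfolding y_def[symmetric]
    proof (rule reflected_zero[OF \<epsilon>])
      show "y (- j) = \<epsilon> * y j" for j
        using sq by (simp add: y_def algebra_simps flip: mult.assoc)
      show "y j = 0" if "\<bar>j\<bar> > N" for j using outside that by (simp add: y_def)
      show "y N = 0 \<or> dn (N - 2) * y (N - 2) = (2 * dn N + of_real (4 * \<kappa>)) * y N"
        using \<epsilon> glue tip by (auto simp: y_def algebra_simps)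
      show "row_eq y j" if "\<bar>j\<bar> < N" for j
      proof -
        have neg: "- (j::int) - 2 + 2 = - j" "- (- j) - 2 = j - 2" "- j + 2 = - (j - 2)" "- j - 2 = - (j + 2)" by auto
        have "row_eq w j" "row_eq w (- j)" using row that by auto
        note rows = this[unfolded row_eq_def neg minus_minus]
        show ?thesis
          unfolding row_eq_def y_def neg
          using arg_cong2[OF rows, of "\<lambda>p q. p + \<epsilon> * q"] by (simp only: algebra_simps)
      qed
    qed (use j in auto)
  qed
  have "w \<bar>j\<bar> = 0" "w (- \<bar>j\<bar>) = 0" using part[of 1] part[of "- 1"] by auto
  then show ?thesis by (cases "j \<ge> 0") auto
qed (use outside in simp)

end

section \<open>The multiplication matrices\<close>

definition band_mat :: "nat \<Rightarrow> complex \<Rightarrow> complex \<Rightarrow> complex \<Rightarrow> complex mat" where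
  "band_mat m d u l = mat (m + 5) (m + 5)
     (\<lambda>(r, c). if r = c then d else if c = r + 2 then u else if r = c + 2 then l else 0)"

lemma Msin2_band: "Msin2 m = band_mat m (1/2) (- 1/4) (- 1/4)"
  by (rule eq_matI) (auto simp: Msin2_def band_mat_def)

lemma Mcossin_band: "Mcossin m = band_mat m 0 (\<i>/4) (- \<i>/4)"
  by (rule eq_matI) (auto simp: Mcossin_def band_mat_def)

text \<open>The entries of \<open>Pmat m *\<^sub>v x\<close>, indexed by frequency from \<open>- m/2\<close> to \<open>m/2\<close> and extended by zero.\<close>

definition pad :: "nat \<Rightarrow> complex vec \<Rightarrow> int \<Rightarrow> complex" where
  "pad m x j = (let N = int (m div 2) in
     if \<bar>j\<bar> = N then x $ 0 / 2 else if \<bar>j\<bar> < N then x $ nat (j + N) else 0)"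

lemma Pmat_mult_vec:
  assumes "x \<in> carrier_vec m" "even m" "m > 0" "r \<le> m"
  shows "(Pmat m *\<^sub>v x) $ r = pad m x (int r - int (m div 2))"
proof -
  \<comment> \<open>Rows 0 and \<open>m\<close> of \<open>Pmat\<close> both read coefficient 0, each
    with weight 1/2.\<close>
  define e where "e = (if r = m then 0 else r)"
  have e: "e < m" using assms by (auto simp: e_def)
  have "(Pmat m *\<^sub>v x) $ r = (\<Sum>c\<in>{0..<m}. Pmat m $$ (r, c) * x $ c)"
    using assms by (simp add: Pmat_def scalar_prod_def)
  also have "\<dots> = (\<Sum>c\<in>{0..<m}. if c = e then (if e = 0 then 1/2 else 1) * x $ c else 0)"
    using assms by (intro sum.cong) (auto simp: Pmat_def e_def)
  also have "\<dots> = (if e = 0 then 1/2 else 1) * x $ e"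
    using e by simp
  also have "\<dots> = pad m x (int r - int (m div 2))"
  proof -
    obtain k where k: "m = 2 * k" using \<open>even m\<close> by blast
    show ?thesis using assms by (auto simp: pad_def Let_def e_def k)
  qed
  finally show ?thesis .
qed

lemma band_sum:
  fixes p :: "nat \<Rightarrow> complex"
  assumes "r \<le> m"
  shows "(\<Sum>c\<in>{0..<m+1}. (if r = c then d else if c = r + 2 then u else if r = c + 2 then l else 0) * p c) =
    d * p r + (if r + 2 \<le> m then u * p (r + 2) else 0) + (if 2 \<le> r then l * p (r - 2) else 0)"
proof -
  \<comment> \<open>The guard \<open>2 \<le> r\<close> compensates the truncated subtraction in
    \<open>r - 2\<close>.\<close>
  have "(\<Sum>c\<in>{0..<m+1}. (if r = c then d else if c = r + 2 then u else if r = c + 2 then l else 0) * p c) =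
    (\<Sum>c\<in>{0..<m+1}. (if c = r then d * p c else 0) + (if c = r + 2 then u * p c else 0) +
      (if c = r - 2 then if 2 \<le> r then l * p c else 0 else 0))"
    by (intro sum.cong) auto
  also have "\<dots> = (\<Sum>c\<in>{0..<m+1}. if c = r then d * p c else 0) +
      (\<Sum>c\<in>{0..<m+1}. if c = r + 2 then u * p c else 0) +
      (\<Sum>c\<in>{0..<m+1}. if c = r - 2 then if 2 \<le> r then l * p c else 0 else 0)"
    by (simp only: sum.distrib)
  also have "\<dots> = d * p r + (if r + 2 \<le> m then u * p (r + 2) else 0) + (if 2 \<le> r then l * p (r - 2) else 0)"
    using assms by (intro arg_cong2[of _ _ _ _ "(+)"]; subst sum.delta) auto
  finally show ?thesis .
qed

text \<open>The Toeplitz matrices have two extra rows on each side, so row \<open>r + 2\<close>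
  belongs to frequency \<open>j\<close>. The zero extension in \<open>pad\<close> makes the formula
  uniform up to the ends.\<close>

lemma cols_band_mult_vec:
  assumes x: "x \<in> carrier_vec m" and m: "even m" "m > 0" and r: "r \<le> m"
  defines "j \<equiv> int r - int (m div 2)"
  shows "(cols_3_to_m3 m (band_mat m d u l) *\<^sub>v (Pmat m *\<^sub>v x)) $ (r + 2) =
    d * pad m x j + u * pad m x (j + 2) + l * pad m x (j - 2)"
proof -
  define p where "p c = pad m x (int c - int (m div 2))" for c
  have "(cols_3_to_m3 m (band_mat m d u l) *\<^sub>v (Pmat m *\<^sub>v x)) $ (r + 2) =
    (\<Sum>c\<in>{0..<m+1}. (if r = c then d else if c = r + 2 then u else if r = c + 2 then l else 0) * p c)"
    using r x m Pmat_mult_vec[OF x m]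
    by (auto simp: cols_3_to_m3_def band_mat_def scalar_prod_def p_def Pmat_def intro!: sum.cong)
  also have "\<dots> = d * p r + (if r + 2 \<le> m then u * p (r + 2) else 0) + (if 2 \<le> r then l * p (r - 2) else 0)"
    using r by (rule band_sum)
  also have "\<dots> = d * pad m x j + u * pad m x (j + 2) + l * pad m x (j - 2)"
  proof -
    have "pad m x (j + 2) = 0" if "\<not> r + 2 \<le> m"
      using that m by (auto simp: pad_def j_def Let_def elim!: evenE)
    moreover have "pad m x (j - 2) = 0" if "\<not> 2 \<le> r"
      using that m by (auto simp: pad_def j_def Let_def elim!: evenE)
    ultimately show ?thesis
      by (auto simp: p_def j_def of_nat_diff algebra_simps)
  qed
  finally show ?thesis .
qed

lemma Qmat_mult_vec:
  assumes "y \<in> carrier_vec (m + 5)" "r < m"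
  shows "(Qmat m *\<^sub>v y) $ r = y $ (r + 2) + (if r = 0 then y $ (m + 2) else 0)"
proof -
  have "(Qmat m *\<^sub>v y) $ r = (\<Sum>c\<in>{0..<m+5}. Qmat m $$ (r, c) * y $ c)"
    using assms by (simp add: Qmat_def scalar_prod_def)
  also have "\<dots> = (\<Sum>c\<in>{0..<m+5}. (if c = r + 2 then y $ c else 0) +
      (if c = m + 2 then if r = 0 then y $ c else 0 else 0))"
    using assms by (intro sum.cong) (auto simp: Qmat_def)
  also have "\<dots> = y $ (r + 2) + (if r = 0 then y $ (m + 2) else 0)"
    using assms by (simp add: sum.distrib)
  finally show ?thesis .
qed

text \<open>\<open>Qmat\<close> folds frequency N onto - N, so row 0 collects both tips.\<close>

lemma mult_band_mult_vec:
  fixes d u l :: complex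
  assumes x: "x \<in> carrier_vec m" and m: "even m" "m > 0" and r: "r < m"
  defines "N \<equiv> int (m div 2)"
  defines "B \<equiv> \<lambda>j. d * pad m x j + u * pad m x (j + 2) + l * pad m x (j - 2)"
  shows "((Qmat m * cols_3_to_m3 m (band_mat m d u l) * Pmat m) *\<^sub>v x) $ r =
    B (int r - N) + (if r = 0 then B N else 0)"
proof -
  define C where "C = cols_3_to_m3 m (band_mat m d u l)"
  have dims: "Qmat m \<in> carrier_mat m (m + 5)" "C \<in> carrier_mat (m + 5) (m + 1)"
    "Pmat m \<in> carrier_mat (m + 1) m"
    by (simp_all add: Qmat_def C_def cols_3_to_m3_def band_mat_def Pmat_def)
  have "(Qmat m * C * Pmat m) *\<^sub>v x = Qmat m *\<^sub>v (C *\<^sub>v (Pmat m *\<^sub>v x))"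
    using dims x by (metis assoc_mult_mat_vec mult_carrier_mat mult_mat_vec_carrier)
  moreover have "C *\<^sub>v (Pmat m *\<^sub>v x) \<in> carrier_vec (m + 5)" using dims x by simp
  moreover have "int m - N = N" using m by (auto simp: N_def)
  ultimately show ?thesis
    using cols_band_mult_vec[OF x m, of r d u l] cols_band_mult_vec[OF x m, of m d u l] r
    by (simp add: Qmat_mult_vec C_def B_def N_def)
qed

lemma Tsin2_carrier: "Tsin2 m \<in> carrier_mat m m"
  by (rule carrier_matI) (simp_all add: Tsin2_def Qmat_def Pmat_def)

lemma Tcossin_carrier: "Tcossin m \<in> carrier_mat m m"
  by (rule carrier_matI) (simp_all add: Tcossin_def Qmat_def Pmat_def)

text \<open>The band entries combine so that frequency j reaches row j - 2 only through - X + i Y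
  and row j + 2 only through - X - i Y. Keeping X and Y abstract serves both the Laplacian and the
  kernel of \<open>Tsin2\<close>.\<close>

lemma (in band) multiplication_zero:
  assumes m: "even m" "m > 0" and Nm: "N = int (m div 2)"
    and v: "v \<in> carrier_vec m" and X: "X \<in> carrier_vec m" and Y: "Y \<in> carrier_vec m"
    and up: "\<And>j. - pad m X j + \<i> * pad m Y j = dn (- j) * pad m v j"
    and down: "\<And>j. - pad m X j - \<i> * pad m Y j = dn j * pad m v j"
    and eq: "\<And>r. r < m \<Longrightarrow> (Tsin2 m *\<^sub>v X) $ r + (Tcossin m *\<^sub>v Y) $ r = of_real \<kappa> * v $ r"
  shows "v = 0\<^sub>v m"
proof -
  define w where "w = pad m v"
  define B where "B j = (1/2) * pad m X j + (- 1/4) * pad m X (j + 2) + (- 1/4) * pad m X (j - 2) +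
    (0 * pad m Y j + (\<i>/4) * pad m Y (j + 2) + (- \<i>/4) * pad m Y (j - 2))" for j
  have lhs: "(Tsin2 m *\<^sub>v X) $ r + (Tcossin m *\<^sub>v Y) $ r =
      B (int r - N) + (if r = 0 then B N else 0)" if "r < m" for r
    unfolding Tsin2_def Tcossin_def Msin2_band Mcossin_band
    using mult_band_mult_vec[OF X m that] mult_band_mult_vec[OF Y m that]
    by (simp add: B_def Nm)
  have B4: "4 * B j = - (dn j + dn (- j)) * w j + dn (- j - 2) * w (j + 2) + dn (j - 2) * w (j - 2)" for j
  proof -
    have "4 * B j = - ((- pad m X j + \<i> * pad m Y j) + (- pad m X j - \<i> * pad m Y j)) +
       (- pad m X (j + 2) + \<i> * pad m Y (j + 2)) + (- pad m X (j - 2) - \<i> * pad m Y (j - 2))"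
      by (simp add: B_def algebra_simps)
    also have "\<dots> = - (dn (- j) * w j + dn j * w j) + dn (- (j + 2)) * w (j + 2) + dn (j - 2) * w (j - 2)"
      unfolding up down w_def ..
    finally show ?thesis by (simp add: algebra_simps)
  qed
  have w0: "w N = v $ 0 / 2" "w (- N) = v $ 0 / 2"
    by (simp_all add: w_def pad_def Nm)
  have wr: "w (int r - N) = v $ r" if "0 < r" "r < m" for r
    using that m by (auto simp: w_def pad_def Nm Let_def elim!: evenE)
  have zero: "w j = 0" for j
  proof (rule band_zero)
    show "w j = 0" if "N < \<bar>j\<bar>" for j using that by (simp add: w_def pad_def Nm)
    then have out: "w (N + 2) = 0" "w (- N - 2) = 0" using N by auto
    show "w (- N) = w N" by (simp add: w0)
    show "row_eq w j" if j: "\<bar>j\<bar> < N" for j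
    proof -
      define r where "r = nat (j + N)"
      have r: "0 < r" "r < m" "j = int r - N"
        using j m by (auto simp: r_def Nm)
      have "B j = of_real \<kappa> * w j"
        using lhs[OF r(2)] eq[OF r(2)] r wr[OF r(1,2)] by simp
      then have "4 * B j = 4 * (of_real \<kappa> * w j)" by simp
      then show ?thesis
        unfolding B4 row_eq_def by (simp add: algebra_simps)
    qed
    \<comment> \<open>Row 0 sees only the sum of the two tips, which gives the condition on the even
      part.\<close>
    have "B (- N) + B N = of_real \<kappa> * v $ 0" using lhs[of 0] eq[of 0] m by simp
    also have "v $ 0 = w N + w (- N)" by (simp add: w0)
    finally have "4 * B (- N) + 4 * B N = 4 * (of_real \<kappa> * (w N + w (- N)))"
      by (metis distrib_left)
    moreover have "dn (- N) = dn N" by (simp add: dn_tip)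
    ultimately show "dn (N - 2) * (w (N - 2) + w (2 - N)) =
        (2 * dn N + of_real (4 * \<kappa>)) * (w N + w (- N))"
      unfolding B4 using out by (simp add: algebra_simps)
  qed
  show ?thesis
  proof (rule eq_vecI)
    fix r assume "r < dim_vec (0\<^sub>v m :: complex vec)"
    then show "v $ r = 0\<^sub>v m $ r"
      using zero w0 wr by (cases "r = 0") auto
  qed (use v in simp)
qed

section \<open>The Laplacian\<close>

text \<open>\<open>inv_mat\<close> is a choice, so an inverse must be shown to exist. A kernel
  vector v fits \<open>multiplication_zero\<close> with X = - v and Y = 0, where every
  \<open>dn\<close> equals 1.\<close>

lemma inv_mat_Tsin2:
  assumes m: "even m" "m > 0"
  shows "inv_mat (Tsin2 m) \<in> carrier_mat m m" "Tsin2 m * inv_mat (Tsin2 m) = 1\<^sub>m m"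
proof -
  let ?T = "Tsin2 m"
  note T = Tsin2_carrier[of m]
  interpret band "int (m div 2)" "\<lambda>_. 0" 0 0 "- 1"
    using m by unfold_locales (auto simp: off_ray_def elim!: evenE)
  have dn1: "dn j = 1" for j by (simp add: dn_def)
  have "det ?T \<noteq> 0"
  proof
    assume "det ?T = 0"
    then obtain v where v: "v \<in> carrier_vec m" "v \<noteq> 0\<^sub>v m" "?T *\<^sub>v v = 0\<^sub>v m"
      using det_0_iff_vec_prod_zero[OF T] by blast
    have "v = 0\<^sub>v m"
    proof (rule multiplication_zero[OF m refl v(1)])
      show "(?T *\<^sub>v ((- 1) \<cdot>\<^sub>v v)) $ r + (Tcossin m *\<^sub>v 0\<^sub>v m) $ r = of_real 0 * v $ r" if "r < m" for r
      proof -
        have "?T *\<^sub>v ((- 1) \<cdot>\<^sub>v v) = (- 1) \<cdot>\<^sub>v (?T *\<^sub>v v)"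
          using T v(1) by (rule mult_mat_vec)
        then show ?thesis using that v(3) Tcossin_carrier[of m] by simp
      qed
    qed (use m v in \<open>auto simp: dn1 pad_def Let_def elim!: evenE\<close>)
    with v show False by simp
  qed
  then obtain B where "B \<in> carrier_mat m m" "?T * B = 1\<^sub>m m" "B * ?T = 1\<^sub>m m"
    using det_non_zero_imp_unit[OF T] unfolding Units_def ring_mat_def by auto
  then have "\<exists>B. B \<in> carrier_mat (dim_row ?T) (dim_row ?T) \<and>
      ?T * B = 1\<^sub>m (dim_row ?T) \<and> B * ?T = 1\<^sub>m (dim_row ?T)"
    using T by auto
  from someI_ex[OF this, folded inv_mat_def]
  show "inv_mat ?T \<in> carrier_mat m m" "?T * inv_mat ?T = 1\<^sub>m m" using T by auto
qed

section \<open>Reduction of the Kronecker products to blocks\<close>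

lemma diagonal_mult_vec:
  fixes A :: "'a::semiring_0 mat"
  assumes "A \<in> carrier_mat m m" "v \<in> carrier_vec m" "r < m"
    and "\<And>c. c < m \<Longrightarrow> c \<noteq> r \<Longrightarrow> A $$ (r, c) = 0"
  shows "(A *\<^sub>v v) $ r = A $$ (r, r) * v $ r"
proof -
  have "(A *\<^sub>v v) $ r = (\<Sum>c\<in>{0..<m}. A $$ (r, c) * v $ c)"
    using assms by (simp add: scalar_prod_def)
  also have "\<dots> = (\<Sum>c\<in>{0..<m}. if c = r then A $$ (r, c) * v $ c else 0)"
    using assms(4) by (intro sum.cong) auto
  finally show ?thesis using assms(3) by simp
qed

definition vec_block :: "nat \<Rightarrow> nat \<Rightarrow> 'a vec \<Rightarrow> 'a vec" where
  "vec_block m p x = vec m (\<lambda>r. x $ (p * m + r))"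

lemma kron_diagonal_mult_vec:
  fixes D A :: "'a::comm_semiring_1 mat"
  assumes D: "D \<in> carrier_mat n n" and diag: "\<And>i j. i < n \<Longrightarrow> j < n \<Longrightarrow> i \<noteq> j \<Longrightarrow> D $$ (i, j) = 0"
    and A: "A \<in> carrier_mat m m" and x: "x \<in> carrier_vec (n * m)" and p: "p < n" and r: "r < m"
  shows "(kron D A *\<^sub>v x) $ (p * m + r) = D $$ (p, p) * (A *\<^sub>v vec_block m p x) $ r"
proof -
  have bound: "q * m + c < n * m" if "q < n" "c < m" for q c
  proof -
    have "q * m + c < Suc q * m" using that by simp
    also have "\<dots> \<le> n * m" using that by (intro mult_le_mono1) simp
    finally show ?thesis .
  qed
  define f where "f j = kron D A $$ (p * m + r, j) * x $ j" for j
  have "(kron D A *\<^sub>v x) $ (p * m + r) = (\<Sum>j<n * m. f j)"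
    using D A x bound[OF p r] by (simp add: kron_def scalar_prod_def f_def atLeast0LessThan)
  also have "\<dots> = (\<Sum>q<n. \<Sum>j\<in>{q * m..<q * m + m}. f j)"
    by (rule sum.nat_group[symmetric])
  also have "\<dots> = (\<Sum>q<n. \<Sum>c<m. f (q * m + c))"
  proof (rule sum.cong[OF refl])
    fix q
    show "(\<Sum>j\<in>{q * m..<q * m + m}. f j) = (\<Sum>c<m. f (q * m + c))"
      using sum.shift_bounds_nat_ivl[of f 0 "q * m" m] by (simp add: atLeast0LessThan add.commute)
  qed
  also have "\<dots> = (\<Sum>q<n. \<Sum>c<m. D $$ (p, q) * A $$ (r, c) * x $ (q * m + c))"
    using D A r bound[OF p r] bound
    by (intro sum.cong refl) (auto simp: f_def kron_def)
  also have "\<dots> = (\<Sum>q<n. if q = p then \<Sum>c<m. D $$ (p, p) * A $$ (r, c) * x $ (p * m + c) else 0)"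
    using diag p by (intro sum.cong refl) auto
  also have "\<dots> = (\<Sum>c<m. D $$ (p, p) * A $$ (r, c) * x $ (p * m + c))"
    using p by simp
  also have "\<dots> = D $$ (p, p) * (A *\<^sub>v vec_block m p x) $ r"
    using A r by (simp add: vec_block_def scalar_prod_def sum_distrib_left mult.assoc atLeast0LessThan)
  finally show ?thesis .
qed

text \<open>Both Kronecker terms have a diagonal left factor, so each block of an eigenvector
  satisfies its own equation; the block that contains a nonzero entry is chosen.\<close>

lemma Lap_block_eigenvector:
  assumes m: "even m" "m > 0" and ev: "eigenvalue (Lap n m) lam"
  obtains p v where "p < n" "v \<in> carrier_vec m" "v \<noteq> 0\<^sub>v m"
    "(D2 m + inv_mat (Tsin2 m) * Tcossin m * Dm m) *\<^sub>v v + (D2 n $$ (p, p)) \<cdot>\<^sub>v (inv_mat (Tsin2 m) *\<^sub>v v) = lam \<cdot>\<^sub>v v"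
proof -
  define R where "R = inv_mat (Tsin2 m)"
  define A where "A = D2 m + R * Tcossin m * Dm m"
  note R = inv_mat_Tsin2(1)[OF m, folded R_def]
  have A: "A \<in> carrier_mat m m" using R by (intro carrier_matI) (simp_all add: A_def Dm_def)
  have D2n: "D2 n \<in> carrier_mat n n" by (simp add: D2_def)
  have L: "Lap n m = kron (1\<^sub>m n) A + kron (D2 n) R"
    by (simp add: Lap_def A_def R_def)
  have K: "kron (1\<^sub>m n) A \<in> carrier_mat (n * m) (n * m)" "kron (D2 n) R \<in> carrier_mat (n * m) (n * m)"
    using A R D2n by (simp_all add: kron_def)
  obtain x where x: "x \<in> carrier_vec (n * m)" "x \<noteq> 0\<^sub>v (n * m)" and eig: "Lap n m *\<^sub>v x = lam \<cdot>\<^sub>v x"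
    using ev K by (auto simp: eigenvalue_def eigenvector_def L)
  obtain i where i: "i < n * m" "x $ i \<noteq> 0"
    using x by (metis carrier_vecD eq_vecI index_zero_vec)
  define p where "p = i div m"
  define v where "v = vec_block m p x"
  have p: "p < n" using i by (simp add: p_def less_mult_imp_div_less)
  have v: "v \<in> carrier_vec m" by (simp add: v_def vec_block_def)
  have "v $ (i mod m) = x $ i" using m by (simp add: v_def vec_block_def p_def)
  then have "v \<noteq> 0\<^sub>v m" using i m by auto
  moreover have "A *\<^sub>v v + (D2 n $$ (p, p)) \<cdot>\<^sub>v (R *\<^sub>v v) = lam \<cdot>\<^sub>v v"
  proof (rule eq_vecI)
    fix r assume "r < dim_vec (lam \<cdot>\<^sub>v v)"
    then have r: "r < m" using v by simp
    have pr: "p * m + r < n * m"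
    proof -
      have "p * m + r < Suc p * m" using r by simp
      also have "\<dots> \<le> n * m" using p by (intro mult_le_mono1) simp
      finally show ?thesis .
    qed
    have "(Lap n m *\<^sub>v x) $ (p * m + r) = (kron (1\<^sub>m n) A *\<^sub>v x) $ (p * m + r) + (kron (D2 n) R *\<^sub>v x) $ (p * m + r)"
      using K x pr by (simp add: L add_mult_distrib_mat_vec[of _ "n * m" "n * m"])
    also have "\<dots> = (A *\<^sub>v v) $ r + D2 n $$ (p, p) * (R *\<^sub>v v) $ r"
      unfolding v_def using p
      by (subst (1 2) kron_diagonal_mult_vec[OF _ _ _ x(1) p r])
         (use A R in \<open>auto simp: D2_def\<close>)
    finally show "(A *\<^sub>v v + (D2 n $$ (p, p)) \<cdot>\<^sub>v (R *\<^sub>v v)) $ r = (lam \<cdot>\<^sub>v v) $ r"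
      using eig r v A R x pr by (simp add: v_def vec_block_def)
  qed (use A R v in simp)
  ultimately show ?thesis using that p v by (simp add: A_def R_def)
qed

theorem theoremA1:
  fixes n m :: nat and lam :: complex
  assumes "even n" "even m" "n > 0" "m > 0"
    and "eigenvalue (Lap n m) lam"
  shows "lam \<in> \<real> \<and> Re lam \<le> 0"
proof (rule ccontr)
  assume neg: "\<not> (lam \<in> \<real> \<and> Re lam \<le> 0)"
  note m = \<open>even m\<close> \<open>m > 0\<close>
  define R where "R = inv_mat (Tsin2 m)"
  note R = inv_mat_Tsin2[OF m, folded R_def]
  note T = Tsin2_carrier[of m]
  note S = Tcossin_carrier[of m]
  obtain p v where p: "p < n" and v: "v \<in> carrier_vec m" "v \<noteq> 0\<^sub>v m" and
    eig: "(D2 m + R * Tcossin m * Dm m) *\<^sub>v v + (D2 n $$ (p, p)) \<cdot>\<^sub>v (R *\<^sub>v v) = lam \<cdot>\<^sub>v v"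
    using Lap_block_eigenvector[OF m assms(5), folded R_def] by metis
  define \<kappa> :: real where "\<kappa> = of_int ((int p - int n div 2)^2)"
  have d: "D2 n $$ (p, p) = - of_real \<kappa>" using p by (simp add: D2_def \<kappa>_def)
  define N where "N = int (m div 2)"
  \<comment> \<open>The negated claim says exactly that \<open>- lam\<close> lies off the closed
    nonnegative ray.\<close>
  interpret band N "\<lambda>j. of_int (j * (j + 1))" "of_int (N\<^sup>2)" \<kappa> "- lam"
  proof
    show "N \<ge> 1" using m by (auto simp: N_def elim!: evenE)
    show "off_ray (- lam)" using neg by (auto simp: off_ray_def complex_is_Real_iff)
    show "(of_int (i * (i + 1)) :: real) \<le> of_int (j * (j + 1))" if "0 \<le> i" "i \<le> j" for i j
      using that unfolding of_int_le_iff by (intro mult_mono) auto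
    show "(of_int ((N - 2) * (N - 2 + 1)) :: real) \<le> of_int (N\<^sup>2)"
      using \<open>N \<ge> 1\<close> unfolding of_int_le_iff by (simp add: power2_eq_square algebra_simps)
  qed (auto simp: \<kappa>_def algebra_simps)
  have D2m: "D2 m \<in> carrier_mat m m" and Dm: "Dm m \<in> carrier_mat m m"
    by (simp_all add: D2_def Dm_def)
  \<comment> \<open>For these vectors, applying \<open>Tsin2 m\<close> to the block equation removes
    the inverse and leaves T X + S Y = \<open>\<kappa>\<close> v.\<close>
  define X where "X = D2 m *\<^sub>v v - lam \<cdot>\<^sub>v v"
  define Y where "Y = Dm m *\<^sub>v v"
  have X: "X \<in> carrier_vec m" and Y: "Y \<in> carrier_vec m"
    using D2m Dm v by (simp_all add: X_def Y_def)
  have X_nth: "X $ r = - (of_int ((int r - N)\<^sup>2) + lam) * v $ r" if "r < m" for r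
  proof -
    have "(D2 m *\<^sub>v v) $ r = D2 m $$ (r, r) * v $ r"
      using that v D2m by (intro diagonal_mult_vec) (auto simp: D2_def)
    then show ?thesis using that v by (simp add: X_def D2_def N_def zdiv_int algebra_simps)
  qed
  have Y_nth: "Y $ r = (if r = 0 then 0 else \<i> * of_int (int r - N)) * v $ r" if "r < m" for r
  proof -
    have "(Dm m *\<^sub>v v) $ r = Dm m $$ (r, r) * v $ r"
      using that v Dm by (intro diagonal_mult_vec) (auto simp: Dm_def)
    then show ?thesis using that v by (simp add: Y_def Dm_def N_def zdiv_int)
  qed
  have sq: "j\<^sup>2 = N\<^sup>2" if "\<bar>j\<bar> = N" for j using that by (metis power2_abs)
  have pX: "pad m X j = - (of_int (j\<^sup>2) + lam) * pad m v j" for j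
  proof (cases "\<bar>j\<bar> = N")
    case True
    have "(int 0 - N)\<^sup>2 = N\<^sup>2" by simp
    then have X0: "X $ 0 = - (of_int (j\<^sup>2) + lam) * v $ 0"
      using X_nth[of 0] m unfolding sq[OF True] by metis
    show ?thesis unfolding pad_def N_def[symmetric] Let_def if_P[OF True] X0 by simp
  next
    case False
    moreover have "nat (j + N) < m" if "\<bar>j\<bar> < N" using that m by (auto simp: N_def)
    ultimately show ?thesis
      using X_nth[of "nat (j + N)"] by (auto simp: pad_def N_def[symmetric] Let_def)
  qed
  have pY: "pad m Y j = (if \<bar>j\<bar> = N then 0 else \<i> * of_int j * pad m v j)" for j
  proof -
    have "nat (j + N) < m \<and> 0 < nat (j + N)" if "\<bar>j\<bar> < N" using that m by (auto simp: N_def)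
    then show ?thesis
      using Y_nth[of 0] Y_nth[of "nat (j + N)"] m by (auto simp: pad_def N_def[symmetric] Let_def)
  qed
  have "v = 0\<^sub>v m"
  proof (rule multiplication_zero[OF m N_def v(1) X Y])
    \<comment> \<open>Away from the tips, X contributes j^2 + \<open>lam\<close> and i Y contributes
      - j, which gives a(- j) + \<open>lam\<close>; at the tips Y vanishes and only N^2 +
      \<open>lam\<close> remains.\<close>
    show "- pad m X j + \<i> * pad m Y j = dn (- j) * pad m v j" for j
    proof (cases "\<bar>j\<bar> = N")
      case True
      then show ?thesis unfolding pX pY dn_def sq[OF True] by (simp add: algebra_simps)
    next
      case False
      then show ?thesis unfolding pX pY dn_def by (simp add: power2_eq_square algebra_simps)
    qed
    show "- pad m X j - \<i> * pad m Y j = dn j * pad m v j" for j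
    proof (cases "\<bar>j\<bar> = N")
      case True
      then show ?thesis unfolding pX pY dn_def sq[OF True] by (simp add: algebra_simps)
    next
      case False
      then show ?thesis unfolding pX pY dn_def by (simp add: power2_eq_square algebra_simps)
    qed
    show "(Tsin2 m *\<^sub>v X) $ r + (Tcossin m *\<^sub>v Y) $ r = of_real \<kappa> * v $ r" if r: "r < m" for r
    proof -
      have TR: "Tsin2 m *\<^sub>v (R *\<^sub>v u) = u" if "u \<in> carrier_vec m" for u
        using that R T by (metis assoc_mult_mat_vec one_mult_mat_vec)
      have RS: "R * Tcossin m \<in> carrier_mat m m" using R(1) S by (rule mult_carrier_mat)
      have "(R * Tcossin m * Dm m) *\<^sub>v v = R *\<^sub>v (Tcossin m *\<^sub>v Y)"
        unfolding assoc_mult_mat_vec[OF RS Dm v(1)] Y_def[symmetric]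
        by (rule assoc_mult_mat_vec[OF R(1) S Y])
      moreover have "(D2 m + R * Tcossin m * Dm m) *\<^sub>v v =
          D2 m *\<^sub>v v + (R * Tcossin m * Dm m) *\<^sub>v v"
        using D2m R(1) S Dm v(1) by (intro add_mult_distrib_mat_vec) auto
      ultimately have "D2 m *\<^sub>v v + R *\<^sub>v (Tcossin m *\<^sub>v Y) + (- of_real \<kappa>) \<cdot>\<^sub>v (R *\<^sub>v v) = lam \<cdot>\<^sub>v v"
        using eig d by simp
      note sum_eq = arg_cong[OF this, of "\<lambda>u. u $ _"]
      have "X = of_real \<kappa> \<cdot>\<^sub>v (R *\<^sub>v v) - R *\<^sub>v (Tcossin m *\<^sub>v Y)"
      proof (rule eq_vecI)
        fix i assume "i < dim_vec (of_real \<kappa> \<cdot>\<^sub>v (R *\<^sub>v v) - R *\<^sub>v (Tcossin m *\<^sub>v Y))"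
        then have "i < m" using R(1) by simp
        then show "X $ i = (of_real \<kappa> \<cdot>\<^sub>v (R *\<^sub>v v) - R *\<^sub>v (Tcossin m *\<^sub>v Y)) $ i"
          using sum_eq[of i] D2m R(1) v(1) by (simp add: X_def algebra_simps)
      qed (use R(1) X in simp)
      also have "Tsin2 m *\<^sub>v \<dots> = of_real \<kappa> \<cdot>\<^sub>v v - Tcossin m *\<^sub>v Y"
        using T R(1) S v(1) Y by (simp add: mult_minus_distrib_mat_vec[of _ m m] mult_mat_vec[of _ m m] TR)
      finally show ?thesis using r v(1) S by simp
    qed
  qed
  with v show False by simp
qed

end
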